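(* Let $0<p<1$, $0<q<1$, and let $L\ge1$ be an integer. The perturbed at $L$-extrema random walk $(X_k)_{k\ge0}$ with parameters $p,q$ and $X_0=0$ (the walk with finite memory) is recurrent if and only if $p+q=1$.
   Context: The perturbed at $L$-extrema random walk (finite memory $L$): $(X_k)_{k\ge0}$ is a nearest-neighbour process on $\mathbb{Z}$ (each step is $\pm1$) such that, conditionally on the history $X_0,\dots,X_k$ with $X_k=x$, the probability that $X_{k+1}=x+1$ equals $p$ if $x=\max_{0\le m\le L\wedge k}X_{k-m}$, equals $q$ if $x=\min_{0\le m\le L\wedge k}X_{k-m}$, and equals $\tfrac12$ otherwise; $X_{k+1}=x-1$ with the complementary probability. If $x$ is both the maximum and the minimum (which happens only at $k=0$), the probability is $\tfrac12$. Recurrent means that $X_n=0$ for infinitely many $n$ almost surely. *)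

theory Defs
  imports "HOL-Probability.Probability"
begin

definition window :: "nat \<Rightarrow> (nat \<Rightarrow> int) \<Rightarrow> nat \<Rightarrow> int set" where
  "window L x k = (\<lambda>m. x (k - m)) ` {0..min L k}"

text \<open>The first clause takes precedence: a site that is both the maximum and the minimum
  of the window is left symmetrically.  For a nearest-neighbour path and \<open>L \<ge> 1\<close> this
  occurs only at \<open>k = 0\<close>.\<close>

definition up_prob :: "real \<Rightarrow> real \<Rightarrow> nat \<Rightarrow> (nat \<Rightarrow> int) \<Rightarrow> nat \<Rightarrow> real" where
  "up_prob p q L x k =
     (if x k = Max (window L x k) \<and> x k = Min (window L x k) then 1 / 2
      else if x k = Max (window L x k) then p
      else if x k = Min (window L x k) then q
      else 1 / 2)"

text \<open>The history takes values in a countable set, so conditioning on it is elementary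
  conditioning on each path \<open>x 0, \<dots>, x k\<close> of positive probability.  The two
  conditional probabilities sum to 1, so almost surely each step is \<open>1\<close> or \<open>- 1\<close>.\<close>

locale perturbed_extrema_walk = prob_space M
  for M :: "'a measure" and p q :: real and L :: nat and X :: "nat \<Rightarrow> 'a \<Rightarrow> int" +
  assumes random_variable: "\<And>k. X k \<in> measurable M (count_space UNIV)"
    and start: "AE \<omega> in M. X 0 \<omega> = 0"
    and step_up: "\<And>k x. \<P>(\<omega> in M. \<forall>i\<le>k. X i \<omega> = x i) > 0 \<Longrightarrow>
      \<P>(\<omega> in M. X (Suc k) \<omega> = x k + 1 \<bar> \<forall>i\<le>k. X i \<omega> = x i) = up_prob p q L x k"
    and step_down: "\<And>k x. \<P>(\<omega> in M. \<forall>i\<le>k. X i \<omega> = x i) > 0 \<Longrightarrow>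
      \<P>(\<omega> in M. X (Suc k) \<omega> = x k - 1 \<bar> \<forall>i\<le>k. X i \<omega> = x i) = 1 - up_prob p q L x k"

definition recurrent :: "'a measure \<Rightarrow> (nat \<Rightarrow> 'a \<Rightarrow> int) \<Rightarrow> bool" where
  "recurrent M X \<longleftrightarrow> (AE \<omega> in M. infinite {n. X n \<omega> = 0})"

end

theory Submission
  imports Defs
begin

text \<open>
  For \<open>q = 1 - p\<close> the walk is invariant under reflection, so the one-step drift is an odd function of
  the window. By ellipticity its conditional expectations decay geometrically, hence the expected
  position converges to a harmonic function \<open>G\<close> of the history that differs from the position by
  a bounded function of the window. Stopping the martingale \<open>G\<close> on leaving \<open>(0, N)\<close> and letting
  \<open>N \<rightarrow> \<infinity>\<close> shows that 0 is hit almost surely.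

  If \<open>p + q > 1\<close>, compare with the symmetric walk with parameters \<open>p, 1 - p\<close> and its function \<open>G\<close>.
  For that walk \<open>G\<close> is larger after a step up than after a step down: if \<open>p \<ge> 1/2\<close>, raising
  steps of the history raises the probability of a step up; if \<open>p \<le> 1/2\<close>, of two paths that meet,
  the one that came from above is the more likely to go up.
  Hence \<open>G\<close> is a submartingale for the walk with parameters \<open>p, q\<close>. Its drift is
  strictly positive after \<open>L\<close> steps down: otherwise, by harmonicity, \<open>G\<close> would not change under a
  further step down, which leaves the window unchanged and lowers the position. An exponential
  supermartingale then shows that the walk stays positive forever with positive probability.
  The case \<open>p + q < 1\<close> follows by reflection.
\<close>

section \<open>Averaging over the next step\<close>

text \<open>A history is the list of its steps, most recent first; \<open>True\<close> is a step up. It encodes the path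
  \<open>\<lambda>i. pos (drop (length w - i) w)\<close>.\<close>

definition pos :: "bool list \<Rightarrow> int" where
  "pos w = (\<Sum>b\<leftarrow>w. if b then 1 else - 1)"

abbreviation rpos :: "bool list \<Rightarrow> real" where
  "rpos w \<equiv> real_of_int (pos w)"

lemma pos_simps [simp]:
  "pos [] = 0" "pos (True # w) = pos w + 1" "pos (False # w) = pos w - 1"
  "pos (v @ w) = pos v + pos w"
  by (simp_all add: pos_def)

lemma pos_replicate [simp]:
  "pos (replicate n True) = int n" "pos (replicate n False) = - int n"
  by (induction n) auto

lemma pos_map_Not [simp]: "pos (map Not w) = - pos w"
  by (induction w) (auto simp: pos_def)

text \<open>Parity: two walks with a common start that are apart at the same time are at least 2
  apart.\<close>

lemma even_pos_diff: "length v = length w \<Longrightarrow> even (pos v - pos w)"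
  by (induction v w rule: list_induct2) (auto simp: pos_def)

lemma pos_take_drop: "pos (take m w) = pos w - pos (drop m w)"
  using pos_simps(4)[of "take m w" "drop m w"] by simp

definition avg :: "(bool list \<Rightarrow> real) \<Rightarrow> (bool list \<Rightarrow> real) \<Rightarrow> bool list \<Rightarrow> real" where
  "avg u f w = u w * f (True # w) + (1 - u w) * f (False # w)"

lemma avg_add: "avg u (\<lambda>w. f w + g w) w = avg u f w + avg u g w"
  and avg_diff: "avg u (\<lambda>w. f w - g w) w = avg u f w - avg u g w"
  and avg_cmult: "avg u (\<lambda>w. a * f w) w = a * avg u f w"
  and avg_const: "avg u (\<lambda>w. a) w = a"
  by (simp_all add: avg_def algebra_simps)

lemma avg_sum: "avg u (\<lambda>w. \<Sum>i\<in>I. f i w) w = (\<Sum>i\<in>I. avg u (f i) w)"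
  by (simp add: avg_def sum_distrib_left sum.distrib)

lemma avg_pow_diff: "(avg u ^^ n) (\<lambda>w. f w - g w) w = (avg u ^^ n) f w - (avg u ^^ n) g w"
proof (induction n arbitrary: w)
  case (Suc n)
  then have "(avg u ^^ n) (\<lambda>w. f w - g w) = (\<lambda>w. (avg u ^^ n) f w - (avg u ^^ n) g w)" by blast
  then show ?case by (simp add: avg_diff)
qed simp

lemma avg_pow_uminus: "(avg u ^^ n) (\<lambda>w. - f w) w = - (avg u ^^ n) f w"
  using avg_pow_diff[of n u "\<lambda>w. 0" f w] avg_pow_diff[of n u f f w] by simp

text \<open>Monotone coupling of the next steps from \<open>w\<close> and \<open>v\<close>: both go
  up with weight \<open>u w\<close>, both go down with weight \<open>1 - u v\<close>, and with the
  remaining weight \<open>u v - u w\<close> only \<open>v\<close> goes up.\<close>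

lemma avg_le_avg:
  assumes u: "0 \<le> u w" "u w \<le> u v" "u v \<le> 1"
    and f: "f (True # w) \<le> f (True # v)" "f (False # w) \<le> f (False # v)" "f (False # w) \<le> f (True # v)"
  shows "avg u f w \<le> avg u f v"
proof -
  have "avg u f v - avg u f w
      = u w * (f (True # v) - f (True # w)) + (1 - u v) * (f (False # v) - f (False # w))
        + (u v - u w) * (f (True # v) - f (False # w))"
    unfolding avg_def by algebra
  moreover have "0 \<le> \<dots>" using u f by (intro add_nonneg_nonneg mult_nonneg_nonneg) auto
  ultimately show ?thesis by linarith
qed

text \<open>The probability, given the history \<open>w\<close>, that the current and the next
  \<open>n\<close> positions all lie in \<open>Z\<close>, as a recursion over the next step;
  \<open>prob_stay\<close> connects it with the process.\<close>

primrec stay :: "(bool list \<Rightarrow> real) \<Rightarrow> int set \<Rightarrow> nat \<Rightarrow> bool list \<Rightarrow> real" where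
  "stay u Z 0 w = (if pos w \<in> Z then 1 else 0)"
| "stay u Z (Suc n) w = (if pos w \<in> Z then avg u (stay u Z n) w else 0)"

lemma stay_outside [simp]: "pos w \<notin> Z \<Longrightarrow> stay u Z n w = 0"
  by (cases n) auto

section \<open>Ellipticity: forced paths, exit from an interval, staying positive\<close>

locale elliptic =
  fixes u :: "bool list \<Rightarrow> real" and \<epsilon> :: real
  assumes eps_pos: "0 < \<epsilon>" and u_lower: "\<epsilon> \<le> u w" and u_upper: "u w \<le> 1 - \<epsilon>"
begin

lemma u_bounds: "0 < u w" "u w < 1" "0 \<le> u w" "u w \<le> 1"
  using eps_pos u_lower[of w] u_upper[of w] by auto

lemma eps_le: "\<epsilon> \<le> 1 / 2"
  using u_lower[of "[]"] u_upper[of "[]"] by linarith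

lemma eps_power: "0 < \<epsilon> ^ n" "\<epsilon> ^ n \<le> 1"
  using eps_pos eps_le by (auto intro: power_le_one)

lemma avg_mono: "(\<And>b. f (b # w) \<le> g (b # w)) \<Longrightarrow> avg u f w \<le> avg u g w"
  unfolding avg_def using u_bounds[of w] by (intro add_mono mult_left_mono) auto

lemma avg_pow_mono: "(\<And>w. f w \<le> g w) \<Longrightarrow> (avg u ^^ n) f w \<le> (avg u ^^ n) g w"
  by (induction n arbitrary: w) (auto intro: avg_mono)

lemma avg_pow_const: "(avg u ^^ n) (\<lambda>w. a) w = a"
  by (induction n arbitrary: w) (auto simp: avg_def algebra_simps)

lemma avg_pow_le: "(\<And>w. f w \<le> B) \<Longrightarrow> (avg u ^^ n) f w \<le> B"
  using avg_pow_mono[of f "\<lambda>_. B" n w] by (simp add: avg_pow_const)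

lemma weight_le:
  assumes "x \<le> B" "y \<le> B" shows "avg u (\<lambda>v. if hd v = b then x else y) w \<le> \<epsilon> * x + (1 - \<epsilon>) * B"
proof -
  have *: "t * x + (1 - t) * y \<le> \<epsilon> * x + (1 - \<epsilon>) * B" if "\<epsilon> \<le> t" "t \<le> 1" for t
  proof -
    have "\<epsilon> * x + (1 - \<epsilon>) * B - (t * x + (1 - t) * y) = (t - \<epsilon>) * (B - x) + (1 - t) * (B - y)"
      by algebra
    moreover have "0 \<le> \<dots>" using that assms by (intro add_nonneg_nonneg mult_nonneg_nonneg) auto
    ultimately show ?thesis by linarith
  qed
  show ?thesis
    using *[of "u w"] *[of "1 - u w"] u_lower[of w] u_upper[of w] u_bounds[of w]
    by (cases b) (auto simp: avg_def algebra_simps)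
qed

lemma minorize_step:
  assumes le: "\<And>v. f v \<le> B" and b: "f (b # w) \<le> e * x + (1 - e) * B" and e: "0 \<le> e"
  shows "avg u f w \<le> e * \<epsilon> * x + (1 - e * \<epsilon>) * B"
proof -
  have "avg u f w = avg u (\<lambda>v. if hd v = b then f (b # w) else f ((\<not> b) # w)) w"
    by (cases b) (auto simp: avg_def)
  also have "\<dots> \<le> \<epsilon> * f (b # w) + (1 - \<epsilon>) * B"
    by (rule weight_le) (auto simp: le)
  also have "\<dots> \<le> \<epsilon> * (e * x + (1 - e) * B) + (1 - \<epsilon>) * B"
    using b eps_pos by simp
  finally show ?thesis by (simp add: algebra_simps)
qed

text \<open>By ellipticity the next steps follow \<open>s\<close> with probability at least
  \<open>\<epsilon> ^ length s\<close>; on all other paths \<open>f\<close> is bounded by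
  \<open>B\<close>.\<close>

lemma avg_pow_minorize:
  assumes "\<And>v. f v \<le> B"
  shows "(avg u ^^ length s) f w \<le> \<epsilon> ^ length s * f (s @ w) + (1 - \<epsilon> ^ length s) * B"
\<comment> \<open>The last entry of \<open>s\<close> is the first step taken, hence the outermost
  \<open>avg\<close>.\<close>
proof (induction s arbitrary: w rule: rev_induct)
  case (snoc b s)
  have "avg u ((avg u ^^ length s) f) w
      \<le> \<epsilon> ^ length s * \<epsilon> * f (s @ b # w) + (1 - \<epsilon> ^ length s * \<epsilon>) * B"
    by (rule minorize_step[where b = b]) (use snoc assms eps_power in \<open>auto intro: avg_pow_le less_imp_le\<close>)
  then show ?case by (simp add: mult.commute)
qed simp

lemma stay_nonneg: "0 \<le> stay u Z n w"
  by (induction n arbitrary: w) (auto simp: avg_def u_bounds)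

lemma stay_le_1: "stay u Z n w \<le> 1"
proof (induction n arbitrary: w)
  case (Suc n)
  then show ?case using avg_mono[of "stay u Z n" w "\<lambda>_. 1"] by (auto simp: avg_const)
qed simp

text \<open>The analogue of \<open>avg_pow_minorize\<close> for \<open>j\<close> forced steps up,
  with the walk killed outside \<open>Z\<close>.\<close>

lemma stay_minorize:
  assumes "\<And>v. stay u Z n v \<le> B" "0 \<le> B"
  shows "stay u Z (j + n) w \<le> \<epsilon> ^ j * stay u Z n (replicate j True @ w) + (1 - \<epsilon> ^ j) * B"
proof (induction j arbitrary: w)
  case (Suc j)
  have le: "stay u Z (j + n) v \<le> B" for v
  proof -
    have "\<epsilon> ^ j * stay u Z n (replicate j True @ v) \<le> \<epsilon> ^ j * B"
      using assms eps_power[of j] by (intro mult_left_mono) auto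
    then show ?thesis using Suc[of v] by (simp add: algebra_simps)
  qed
  \<comment> \<open>Settles the case of a position outside \<open>Z\<close>, where
    \<open>stay\<close> is 0.\<close>
  have nn: "0 \<le> \<epsilon> ^ Suc j * stay u Z n (replicate (Suc j) True @ w) + (1 - \<epsilon> ^ Suc j) * B"
    using assms eps_power[of "Suc j"] stay_nonneg
    by (intro add_nonneg_nonneg mult_nonneg_nonneg) (auto simp del: power_Suc)
  have "avg u (stay u Z (j + n)) w
      \<le> \<epsilon> ^ j * \<epsilon> * stay u Z n (replicate j True @ True # w) + (1 - \<epsilon> ^ j * \<epsilon>) * B"
    by (rule minorize_step[where b = True]) (use le Suc eps_power in \<open>auto intro: less_imp_le\<close>)
  then show ?case using nn by (simp add: replicate_app_Cons_same mult.commute)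
qed simp

text \<open>From any point of the interval, \<open>N\<close> consecutive steps up lead out of it, so
  each block of \<open>N\<close> steps is survived with probability at most
  \<open>1 - \<epsilon> ^ N\<close>.\<close>

lemma stay_interval_le:
  "stay u {0<..<int N} (m * N) w \<le> (1 - \<epsilon> ^ N) ^ m"
proof (induction m arbitrary: w)
  case 0
  then show ?case using stay_le_1[of _ 0] by simp
next
  case (Suc m)
  show ?case
  proof (cases "pos w \<in> {0<..<int N}")
    case True
    then have "pos (replicate N True @ w) \<notin> {0<..<int N}" by auto
    then show ?thesis
      using stay_minorize[of "{0<..<int N}" "m * N", OF Suc, of N w] eps_power[of N] by simp
  next
    case False
    then show ?thesis using eps_power[of N] by simp
  qed
qed

text \<open>Optional stopping: to stay positive, the walk must stay below \<open>N\<close> or reach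
  \<open>N\<close>. The harmonic function \<open>(G w + K) / N\<close> is nonnegative at nonnegative
  positions and at least 1 from \<open>N\<close> on, so it dominates the probability of reaching
  \<open>N\<close>.\<close>

lemma stay_positive_le:
  assumes harm: "\<And>w. avg u G w = G w" and lower: "\<And>w. rpos w \<le> G w + K"
    and N: "0 < N" and w: "0 \<le> pos w"
  shows "stay u {0<..} n w \<le> (G w + K) / real N + stay u {0<..<int N} n w"
  using w
proof (induction n arbitrary: w)
  have nn: "0 \<le> (G w + K) / real N" if "0 \<le> pos w" for w
    using lower[of w] that N by (intro divide_nonneg_pos) auto
  have large: "1 \<le> (G w + K) / real N" if "int N \<le> pos w" for w
    using lower[of w] that N by (simp add: field_simps)
  {
    case 0
    then show ?case using nn[of w] large[of w] by auto
  next
    case (Suc n)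
    consider "pos w = 0" | "int N \<le> pos w" | "pos w \<in> {0<..<int N}" using Suc.prems by fastforce
    then show ?case
    proof cases
      case 1
      then show ?thesis using nn[of w] by simp
    next
      case 2
      then show ?thesis using large[of w] stay_le_1[of "{0<..}" "Suc n" w]
          stay_nonneg[of "{0<..<int N}" "Suc n" w] by linarith
    next
      case 3
      have "avg u (stay u {0<..} n) w \<le> avg u (\<lambda>w. (G w + K) / real N + stay u {0<..<int N} n w) w"
        using 3 by (intro avg_mono Suc.IH) (auto split: bool.split simp: pos_def)
      also have "\<dots> = avg u (\<lambda>w. inverse (real N) * (G w + K)) w + avg u (stay u {0<..<int N} n) w"
        by (simp add: avg_add divide_inverse mult.commute)
      also have "\<dots> = (G w + K) / real N + avg u (stay u {0<..<int N} n) w"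
        by (simp add: avg_cmult avg_add avg_const harm divide_inverse mult.commute)
      finally show ?thesis using 3 by simp
    qed
  }
qed

text \<open>Optional stopping at 0: the submartingale \<open>\<psi>\<close> is nonpositive if 0 has
  been hit and at most 1 otherwise.\<close>

lemma stay_positive_ge:
  assumes sub: "\<And>w. \<psi> w \<le> avg u \<psi> w" and "\<And>w. \<psi> w \<le> 1" and "\<And>w. pos w = 0 \<Longrightarrow> \<psi> w \<le> 0"
    and w: "0 \<le> pos w"
  shows "\<psi> w \<le> stay u {0<..} n w"
  using w
proof (induction n arbitrary: w)
  case 0
  then show ?case using assms(2,3)[of w] by (cases "pos w = 0") auto
next
  case (Suc n)
  show ?case
  proof (cases "pos w = 0")
    case False
    have "\<psi> w \<le> avg u \<psi> w" by (rule sub)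
    also have "\<dots> \<le> avg u (stay u {0<..} n) w"
      using False Suc.prems by (intro avg_mono Suc.IH) (auto simp: pos_def)
    finally show ?thesis using False Suc.prems by simp
  qed (use assms(3)[of w] in auto)
qed

text \<open>First \<open>N\<close> is taken so large that reaching \<open>N\<close> before 0 is
  unlikely, then \<open>m\<close> so large that staying strictly between 0 and \<open>N\<close> for
  \<open>m * N\<close> steps is unlikely.\<close>

lemma stay_positive_vanishes:
  fixes G :: "bool list \<Rightarrow> real"
  assumes harm: "\<And>w. avg u G w = G w" and near: "\<And>w. \<bar>G w - pos w\<bar> \<le> K" and r: "0 < r"
  shows "\<exists>n. stay u {0<..} n w < r"
proof (cases "0 \<le> pos w")
  case True
  obtain N :: nat where N: "2 * (G w + K) / r < N" "0 < N"
    using reals_Archimedean2[of "max 0 (2 * (G w + K) / r)"] by auto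
  then have 1: "(G w + K) / N < r / 2" using r by (simp add: field_simps)
  obtain m where m: "(1 - \<epsilon> ^ N) ^ m < r / 2"
    using real_arch_pow_inv[of "r / 2" "1 - \<epsilon> ^ N"] r eps_power[of N] by auto
  have lower: "rpos w \<le> G w + K" for w using near[of w] by linarith
  have "stay u {0<..} (m * N) w \<le> (G w + K) / N + (1 - \<epsilon> ^ N) ^ m"
    using stay_positive_le[OF harm lower N(2) True, of "m * N"] stay_interval_le[of N m w] by linarith
  with 1 m show ?thesis by (intro exI[of _ "m * N"]) linarith
qed (use r in auto)

end

lemma take_Cons_take: "take L (b # take L w) = take L (b # w)"
  by (cases L) simp_all

lemma summable_power_div:
  fixes a :: real
  assumes "0 < a" "a < 1" "0 < L"
  shows "summable (\<lambda>n. a ^ (n div L))"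
proof (rule summable_comparison_test')
  \<comment> \<open>The ratio of the comparison series; its factor \<open>inverse (?r ^ L)\<close>
    pays for the rounding in \<open>n div L\<close>.\<close>
  let ?r = "root L a"
  have r: "0 < ?r" "?r < 1" using assms by auto
  show "summable (\<lambda>n. inverse (?r ^ L) * ?r ^ n)"
    using r by (intro summable_mult summable_geometric) auto
  show "norm (a ^ (n div L)) \<le> inverse (?r ^ L) * ?r ^ n" for n
  proof -
    have "a ^ (n div L) = (?r ^ L) ^ (n div L)"
      using assms by simp
    also have "\<dots> = ?r ^ (L * (n div L))" by (simp add: power_mult)
    finally have eq: "a ^ (n div L) * ?r ^ L = ?r ^ (L * (n div L) + L)" by (simp add: power_add)
    have "n \<le> L * (n div L) + L"
      using assms(3) mod_less_divisor[of L n] mult_div_mod_eq[of L n] by linarith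
    then have "?r ^ (L * (n div L) + L) \<le> ?r ^ n"
      using r by (intro power_decreasing) auto
    with eq have "a ^ (n div L) * ?r ^ L \<le> ?r ^ n" by simp
    then show ?thesis using r assms by (simp add: field_simps)
  qed
qed

section \<open>The limit of the expected position of the symmetric walk\<close>

locale symmetric_memory = elliptic +
  fixes L :: nat
  assumes L_pos: "0 < L"
    and u_take: "u (take L w) = u w"
    and u_reflect: "u (map Not w) = 1 - u w"
begin

text \<open>The current window and the next step determine the next window, so averaging preserves
  functions of the window.\<close>

lemma avg_pow_take:
  assumes "\<And>w. f (take L w) = f w" shows "(avg u ^^ n) f (take L w) = (avg u ^^ n) f w"
proof (induction n arbitrary: w)
  case (Suc n)
  have "(avg u ^^ n) f (b # take L w) = (avg u ^^ n) f (b # w)" for b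
    using Suc[of "b # take L w"] Suc[of "b # w"] by (simp only: take_Cons_take)
  then show ?case by (simp add: avg_def[of u "(avg u ^^ n) f"] u_take)
qed (simp add: assms)

lemma avg_pow_odd:
  assumes "\<And>w. f (map Not w) = - f w" shows "(avg u ^^ n) f (map Not w) = - (avg u ^^ n) f w"
proof (induction n arbitrary: w)
  case (Suc n)
  then show ?case using Suc[of "True # w"] Suc[of "False # w"] by (simp add: avg_def u_reflect)
qed (simp add: assms)

text \<open>Every window is reached from everywhere in \<open>L\<close> steps, and an odd function is nonpositive at
  a window or at its reflection.\<close>

lemma odd_contract_upper:
  assumes take: "\<And>w. f (take L w) = f w" and odd: "\<And>w. f (map Not w) = - f w"
    and B: "\<And>w. f w \<le> B"
  shows "(avg u ^^ L) f w \<le> (1 - \<epsilon> ^ L) * B"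
proof -
  obtain s where s: "length s = L" "f s \<le> 0"
    using odd[of "replicate L True"] that[of "replicate L True"] that[of "replicate L False"]
    by fastforce
  have "f (s @ w) \<le> 0" using take[of "s @ w"] s by simp
  then have "\<epsilon> ^ L * f (s @ w) \<le> 0" using eps_power[of L] by (simp add: mult_le_0_iff)
  then show ?thesis using avg_pow_minorize[of f B s w] B s(1) by simp
qed

lemma odd_contract:
  assumes take: "\<And>w. f (take L w) = f w" and odd: "\<And>w. f (map Not w) = - f w"
    and B: "\<And>w. \<bar>f w\<bar> \<le> B"
  shows "\<bar>(avg u ^^ L) f w\<bar> \<le> (1 - \<epsilon> ^ L) * B"
proof -
  have le: "f w \<le> B" "- f w \<le> B" for w using B[of w] by auto
  show ?thesis
    using odd_contract_upper[of f B w] odd_contract_upper[of "\<lambda>w. - f w" B w] le take odd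
    by (simp add: avg_pow_uminus abs_le_iff)
qed

definition drift :: "bool list \<Rightarrow> real" where "drift w = avg u rpos w - pos w"

lemma drift_eq: "drift w = 2 * u w - 1"
  by (simp add: drift_def avg_def algebra_simps)

lemma drift_take: "drift (take L w) = drift w" and drift_odd: "drift (map Not w) = - drift w"
  by (simp_all add: drift_eq u_take u_reflect)

text \<open>The iterates of the drift remain odd functions of the window, so each block of
  \<open>L\<close> steps contracts them by \<open>odd_contract\<close>.\<close>

lemma drift_decay: "\<bar>(avg u ^^ n) drift w\<bar> \<le> (1 - \<epsilon> ^ L) ^ (n div L)"
proof (induction n arbitrary: w rule: less_induct)
  case (less n)
  show ?case
  proof (cases "n < L")
    case True
    have d: "drift v \<le> 1" "- drift v \<le> 1" for v using u_bounds[of v] by (auto simp: drift_eq)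
    show ?thesis
      using True avg_pow_le[of drift 1 n w] avg_pow_le[of "\<lambda>w. - drift w" 1 n w] d
      by (simp add: avg_pow_uminus abs_le_iff)
  next
    case False
    then have n: "n = L + (n - L)" "n div L = Suc ((n - L) div L)"
      using L_pos by (auto simp: le_div_geq)
    have "\<bar>(avg u ^^ L) ((avg u ^^ (n - L)) drift) w\<bar> \<le> (1 - \<epsilon> ^ L) * (1 - \<epsilon> ^ L) ^ ((n - L) div L)"
      using False L_pos by (intro odd_contract avg_pow_take avg_pow_odd drift_take drift_odd less) auto
    moreover have "(avg u ^^ n) drift w = (avg u ^^ L) ((avg u ^^ (n - L)) drift) w"
      using n(1) funpow_add[of L "n - L" "avg u"] by (metis comp_apply)
    ultimately show ?thesis by (simp add: n(2))
  qed
qed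

lemma summable_bound: "summable (\<lambda>n. (1 - \<epsilon> ^ L) ^ (n div L))"
proof (rule summable_power_div)
  have "\<epsilon> ^ L \<le> \<epsilon> ^ 1" using L_pos eps_pos eps_le by (intro power_decreasing) auto
  then show "0 < 1 - \<epsilon> ^ L" using eps_le by simp
qed (use eps_power L_pos in auto)

lemma summable_drift_abs: "summable (\<lambda>n. \<bar>(avg u ^^ n) drift w\<bar>)"
  by (rule summable_comparison_test'[OF summable_bound]) (use drift_decay in auto)

lemma summable_drift: "summable (\<lambda>n. (avg u ^^ n) drift w)"
  using summable_drift_abs by (rule summable_rabs_cancel)

text \<open>Neumann series for the Poisson equation \<open>h - avg u h = drift\<close>; adding its
  solution to the position cancels the drift.\<close>

definition corrector :: "bool list \<Rightarrow> real" where
  "corrector w = (\<Sum>n. (avg u ^^ n) drift w)"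

definition potential :: "bool list \<Rightarrow> real" where
  "potential w = pos w + corrector w"

lemma corrector_take: "corrector (take L w) = corrector w"
  by (simp add: corrector_def avg_pow_take drift_take)

lemma potential_bounded: "\<exists>K. \<forall>w. \<bar>potential w - pos w\<bar> \<le> K"
proof (intro exI allI)
  fix w
  have "\<bar>corrector w\<bar> \<le> (\<Sum>n. \<bar>(avg u ^^ n) drift w\<bar>)"
    unfolding corrector_def by (rule summable_rabs[OF summable_drift_abs])
  also have "\<dots> \<le> (\<Sum>n. (1 - \<epsilon> ^ L) ^ (n div L))"
    by (rule suminf_le) (use drift_decay summable_drift_abs summable_bound in auto)
  finally show "\<bar>potential w - pos w\<bar> \<le> (\<Sum>n. (1 - \<epsilon> ^ L) ^ (n div L))"
    by (simp add: potential_def)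
qed

lemma avg_corrector: "avg u corrector w = corrector w - drift w"
proof -
  have "avg u corrector w = (\<Sum>n. u w * (avg u ^^ n) drift (True # w)) + (\<Sum>n. (1 - u w) * (avg u ^^ n) drift (False # w))"
    by (simp add: avg_def corrector_def suminf_mult summable_drift)
  also have "\<dots> = (\<Sum>n. (avg u ^^ Suc n) drift w)"
    by (subst suminf_add) (auto simp: avg_def intro!: summable_mult summable_drift)
  also have "\<dots> = corrector w - drift w"
    unfolding corrector_def by (subst suminf_split_head) (auto intro: summable_drift)
  finally show ?thesis .
qed

lemma avg_potential: "avg u potential w = potential w"
  unfolding potential_def using avg_corrector[of w] by (simp add: avg_add drift_def)

text \<open>The expected position is the position plus the accumulated expected drifts. Through this
  limit, monotonicity of expected positions passes to \<open>potential\<close>.\<close>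

lemma potential_limit: "(\<lambda>n. (avg u ^^ n) rpos w) \<longlonglongrightarrow> potential w"
proof -
  have "(avg u ^^ Suc n) rpos w - (avg u ^^ n) rpos w = (avg u ^^ n) drift w" for n
    using avg_pow_diff[of n u "avg u rpos" rpos w]
    unfolding drift_def funpow_Suc_right comp_def by simp
  then have "(avg u ^^ n) rpos w = pos w + (\<Sum>i<n. (avg u ^^ i) drift w)" for n
    using sum_lessThan_telescope[of "\<lambda>n. (avg u ^^ n) rpos w" n] by simp
  moreover have "(\<lambda>n. pos w + (\<Sum>i<n. (avg u ^^ i) drift w)) \<longlonglongrightarrow> potential w"
    unfolding potential_def corrector_def
    by (intro tendsto_add tendsto_const summable_LIMSEQ summable_drift)
  ultimately show ?thesis by simp
qed

end

section \<open>Monotonicity in the history\<close>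

text \<open>\<open>pos (take m w)\<close> is the current position minus the position
  \<open>m\<close> steps earlier, so only increments matter and not the position itself.\<close>

definition at_max :: "nat \<Rightarrow> bool list \<Rightarrow> bool" where
  "at_max L w \<longleftrightarrow> (\<forall>m\<le>L. 0 \<le> pos (take m w))"

definition at_min :: "nat \<Rightarrow> bool list \<Rightarrow> bool" where
  "at_min L w \<longleftrightarrow> (\<forall>m\<le>L. pos (take m w) \<le> 0)"

definition bias :: "real \<Rightarrow> real \<Rightarrow> nat \<Rightarrow> bool list \<Rightarrow> real" where
  "bias p q L w =
     (if at_max L w \<and> at_min L w then 1 / 2
      else if at_max L w then p
      else if at_min L w then q
      else 1 / 2)"

lemma extrema_take [simp]: "at_max L (take L w) = at_max L w" "at_min L (take L w) = at_min L w"
  by (auto simp: at_max_def at_min_def min_def)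

lemma extrema_reflect [simp]: "at_max L (map Not w) = at_min L w" "at_min L (map Not w) = at_max L w"
  by (auto simp: at_max_def at_min_def take_map)

lemma elliptic_bias:
  assumes "0 < p" "p < 1" "0 < q" "q < 1"
  shows "elliptic (bias p q L) (min (min p (1 - p)) (min q (1 - q)))"
  using assms by unfold_locales (auto simp: bias_def min_def)

lemma symmetric_memory_bias:
  assumes "0 < p" "p < 1" "0 < L"
  shows "symmetric_memory (bias p (1 - p) L) (min p (1 - p)) L"
  using assms by unfold_locales (auto simp: bias_def min_def)

text \<open>Raising steps increases every increment up to the present: a maximum remains one and no
  minimum is created. For \<open>p \<ge> 1 / 2\<close> a maximum favours a step up and a minimum a
  step down.\<close>

lemma bias_mono_steps:
  assumes "1 / 2 \<le> p" "list_all2 (\<lambda>a b. b \<longrightarrow> a) v w"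
  shows "bias p (1 - p) L w \<le> bias p (1 - p) L v"
proof -
  have pos_le: "pos w \<le> pos v" if "list_all2 (\<lambda>a b. b \<longrightarrow> a) v w" for v w
    using that by induction (auto simp: pos_def)
  have "pos (take m w) \<le> pos (take m v)" for m
    using assms(2) by (intro pos_le list_all2_takeI)
  then have "at_max L w \<Longrightarrow> at_max L v" "at_min L v \<Longrightarrow> at_min L w"
    unfolding at_max_def at_min_def by (meson order_trans)+
  then show ?thesis using assms(1) by (auto simp: bias_def)
qed

lemma avg_pow_mono_steps:
  assumes p: "1 / 2 \<le> p" "p < 1" and "list_all2 (\<lambda>a b. b \<longrightarrow> a) v w"
  shows "(avg (bias p (1 - p) L) ^^ n) rpos w \<le> (avg (bias p (1 - p) L) ^^ n) rpos v"
  using assms(3)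
proof (induction n arbitrary: v w)
  case 0
  then have "pos w \<le> pos v" by induction (auto simp: pos_def)
  then show ?case by simp
next
  case (Suc n)
  interpret elliptic "bias p (1 - p) L" "min (min p (1 - p)) (min (1 - p) (1 - (1 - p)))"
    using p by (intro elliptic_bias) auto
  show ?case
    unfolding funpow.simps comp_def
    by (rule avg_le_avg)
      (use Suc p u_bounds in \<open>auto intro: bias_mono_steps\<close>)
qed

text \<open>\<open>drop i w\<close> is the history \<open>i\<close> steps ago, so this orders the
  positions at equal times; the individual steps need not be ordered.\<close>

definition path_below :: "bool list \<Rightarrow> bool list \<Rightarrow> bool" where
  "path_below w v \<longleftrightarrow> length w = length v \<and> (\<forall>i. pos (drop i w) \<le> pos (drop i v))"

lemma path_below_pos: "path_below w v \<Longrightarrow> pos w \<le> pos v"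
  unfolding path_below_def by (metis drop0)

lemma path_below_Cons:
  "path_below w v \<Longrightarrow> pos (b # w) \<le> pos (c # v) \<Longrightarrow> path_below (b # w) (c # v)"
  by (auto simp: path_below_def drop_Cons split: nat.split)

text \<open>Of two paths with the same endpoint, the lower one is at a maximum whenever the upper
  one is, and the upper one at a minimum whenever the lower one is. For \<open>p \<le> 1 / 2\<close>
  a maximum favours a step down and a minimum a step up.\<close>

lemma bias_mono_path:
  assumes "p \<le> 1 / 2" "path_below w v" "pos w = pos v"
  shows "bias p (1 - p) L w \<le> bias p (1 - p) L v"
proof -
  have "pos (take m v) \<le> pos (take m w)" for m
    using assms(2,3) by (auto simp: path_below_def pos_take_drop)
  then have "at_max L v \<Longrightarrow> at_max L w" "at_min L w \<Longrightarrow> at_min L v"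
    unfolding at_max_def at_min_def by (meson order_trans)+
  then show ?thesis using assms(1) by (auto simp: bias_def)
qed

lemma avg_pow_mono_path:
  assumes p: "0 < p" "p \<le> 1 / 2" and "path_below w v"
  shows "(avg (bias p (1 - p) L) ^^ n) rpos w \<le> (avg (bias p (1 - p) L) ^^ n) rpos v"
  using assms(3)
proof (induction n arbitrary: v w)
  case 0
  then show ?case using path_below_pos by simp
next
  case (Suc n)
  interpret elliptic "bias p (1 - p) L" "min (min p (1 - p)) (min (1 - p) (1 - (1 - p)))"
    using p by (intro elliptic_bias) auto
  let ?f = "(avg (bias p (1 - p) L) ^^ n) rpos"
  have IH: "?f (b # w) \<le> ?f (c # v)" if "pos (b # w) \<le> pos (c # v)" for b c
    using Suc.prems that by (intro Suc.IH path_below_Cons)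
  show ?case
  proof (cases "pos w = pos v")
    case True
    show ?thesis
      unfolding funpow.simps comp_def
      by (rule avg_le_avg)
        (use Suc.prems True p u_bounds in \<open>auto intro: bias_mono_path IH\<close>)
  next
    case False
    \<comment> \<open>By parity the paths are at least 2 apart here, so no pair of next steps
      reverses their order and no comparison of the biases is needed.\<close>
    have "even (pos v - pos w)" using Suc.prems by (intro even_pos_diff) (simp add: path_below_def)
    with False path_below_pos[OF Suc.prems] have far: "pos w + 2 \<le> pos v"
      by presburger
    have cross: "?f (b # w) \<le> ?f (c # v)" for b c
      using far by (intro IH) (cases b; cases c; simp)
    let ?m = "max (?f (True # w)) (?f (False # w))"
    have "avg (bias p (1 - p) L) ?f w \<le> avg (bias p (1 - p) L) (\<lambda>_. ?m) w"
      by (rule avg_mono) (case_tac b; simp)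
    also have "\<dots> = avg (bias p (1 - p) L) (\<lambda>_. ?m) v" by (simp add: avg_const)
    also have "\<dots> \<le> avg (bias p (1 - p) L) ?f v"
      by (rule avg_mono) (simp add: cross)
    finally show ?thesis by simp
  qed
qed

lemma avg_pow_step_mono:
  assumes "0 < p" "p < 1"
  shows "(avg (bias p (1 - p) L) ^^ n) rpos (False # w) \<le> (avg (bias p (1 - p) L) ^^ n) rpos (True # w)"
proof (cases "1 / 2 \<le> p")
  case True
  then show ?thesis using assms by (intro avg_pow_mono_steps) (auto simp: list_all2_refl)
next
  case False
  then show ?thesis
    using assms by (intro avg_pow_mono_path path_below_Cons) (auto simp: path_below_def)
qed

section \<open>Escape under a positive drift\<close>

lemma exp_quadratic_bound: "exp x \<le> 1 + x + x\<^sup>2" if "\<bar>x\<bar> \<le> 1" for x :: real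
proof (cases "0 \<le> x")
  case True
  then show ?thesis using that by (intro exp_bound) auto
next
  case False
  define y where "y = - x"
  have y: "0 < y" using False by (simp add: y_def)
  have "exp x * (1 + y) \<le> exp x * exp y" by (intro mult_left_mono exp_ge_add_one_self) auto
  also have "\<dots> = 1" by (simp add: y_def exp_minus)
  \<comment> \<open>The product equals 1 plus the cube of \<open>y\<close>.\<close>
  also have "\<dots> \<le> (1 - y + y\<^sup>2) * (1 + y)"
    using y by (simp add: algebra_simps power2_eq_square)
  finally show ?thesis using y by (simp add: y_def)
qed

context elliptic
begin

lemma avg_pow_near_pos:
  fixes G :: "bool list \<Rightarrow> real"
  assumes "\<And>w. \<bar>G w - pos w\<bar> \<le> K"
  shows "\<bar>(avg u ^^ n) G w - pos w\<bar> \<le> K + n"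
proof (induction n arbitrary: w)
  case (Suc n)
  have *: "pos w - (K + n + 1) \<le> (avg u ^^ n) G (b # w)" "(avg u ^^ n) G (b # w) \<le> pos w + (K + n + 1)" for b
    using Suc[of "b # w"] by (cases b; simp)+
  then show ?case
    using avg_mono[of "\<lambda>_. pos w - (K + n + 1)" w "(avg u ^^ n) G"]
      avg_mono[of "(avg u ^^ n) G" w "\<lambda>_. pos w + (K + n + 1)"]
    by (simp add: avg_const abs_le_iff)
qed (simp add: assms)

text \<open>Averaging over the first \<open>L + 1\<close> iterates turns a drift at a single window into a drift
  that is bounded below everywhere.\<close>

lemma uniform_drift:
  fixes G :: "bool list \<Rightarrow> real"
  assumes near: "\<And>w. \<bar>G w - pos w\<bar> \<le> K" and sub: "\<And>w. G w \<le> avg u G w"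
    and s: "length s = L" and gain: "\<And>w. G (s @ w) + \<eta> \<le> avg u G (s @ w)" and \<eta>: "0 < \<eta>"
  obtains S K' c where "0 < c" "\<And>w. S w + c \<le> avg u S w" "\<And>w. \<bar>S w - real (Suc L) * pos w\<bar> \<le> K'"
proof
  define S where "S w = (\<Sum>i<Suc L. (avg u ^^ i) G w)" for w
  show "0 < \<epsilon> ^ L * \<eta>" using \<eta> eps_power by simp
  show "S w + \<epsilon> ^ L * \<eta> \<le> avg u S w" for w
  proof -
    \<comment> \<open>Averaging shifts the iterates by one, so the drift of \<open>S\<close>
      telescopes to the last iterate minus the first.\<close>
    have "avg u S w = (\<Sum>i<Suc L. (avg u ^^ Suc i) G w)"
      unfolding S_def by (simp only: avg_sum funpow.simps comp_def)
    also have "\<dots> = S w + ((avg u ^^ Suc L) G w - G w)"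
      using sum_lessThan_telescope[of "\<lambda>i. (avg u ^^ i) G w" "Suc L"]
      unfolding S_def sum_subtractf by simp
    finally have eq: "avg u S w = S w + ((avg u ^^ Suc L) G w - G w)" .
    have mono: "(avg u ^^ n) G w \<le> (avg u ^^ Suc n) G w" for n
      using avg_pow_mono[of G "avg u G" n w] sub unfolding funpow_Suc_right comp_def by simp
    have "G w \<le> (avg u ^^ L) G w"
      using lift_Suc_mono_le[of "\<lambda>n. (avg u ^^ n) G w" 0 L] mono by simp
    \<comment> \<open>Between iterates \<open>L\<close> and \<open>L + 1\<close> the increment is
      the drift of \<open>G\<close> averaged over \<open>L\<close> steps; it is nonnegative, and the
      path \<open>s\<close> contributes at least \<open>\<epsilon> ^ L * \<eta>\<close>.\<close>
    moreover have "(avg u ^^ L) (\<lambda>w. G w - avg u G w) w \<le> \<epsilon> ^ L * (G (s @ w) - avg u G (s @ w))"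
      using avg_pow_minorize[of "\<lambda>w. G w - avg u G w" 0 s w] sub s by simp
    moreover have "\<epsilon> ^ L * (G (s @ w) - avg u G (s @ w)) \<le> \<epsilon> ^ L * (- \<eta>)"
      using gain[of w] eps_power[of L] by (intro mult_left_mono) auto
    moreover have "(avg u ^^ L) (\<lambda>w. G w - avg u G w) w = (avg u ^^ L) G w - (avg u ^^ Suc L) G w"
      unfolding funpow_Suc_right comp_def by (rule avg_pow_diff)
    ultimately show ?thesis using eq by simp
  qed
  show "\<bar>S w - real (Suc L) * pos w\<bar> \<le> (\<Sum>i<Suc L. K + i)" for w
  proof -
    have "S w - real (Suc L) * pos w = (\<Sum>i<Suc L. (avg u ^^ i) G w - pos w)"
      unfolding S_def sum_subtractf by (simp only: sum_constant card_lessThan)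
    then show ?thesis
      using sum_abs[of "\<lambda>i. (avg u ^^ i) G w - pos w" "{..<Suc L}"]
        sum_mono[of "{..<Suc L}" "\<lambda>i. \<bar>(avg u ^^ i) G w - pos w\<bar>" "\<lambda>i. K + i"]
        avg_pow_near_pos[OF near] by fastforce
  qed
qed

text \<open>The bound \<open>\<theta> * B \<le> 1\<close> allows the quadratic estimate of the
  exponential; \<open>\<theta> * B\<^sup>2 \<le> c\<close> makes the linear gain from the drift
  outweigh the quadratic term.\<close>

lemma exp_supermartingale:
  assumes drift: "\<And>w. S w + c \<le> avg u S w" and incr: "\<And>b w. \<bar>S (b # w) - S w\<bar> \<le> B"
    and \<theta>: "0 < \<theta>" "\<theta> * B \<le> 1" "\<theta> * B\<^sup>2 \<le> c"
  shows "avg u (\<lambda>w. exp (- \<theta> * S w)) w \<le> exp (- \<theta> * S w)"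
proof -
  have step: "exp (- \<theta> * S (b # w)) \<le> exp (- \<theta> * S w) * (1 + \<theta> * S w + \<theta>\<^sup>2 * B\<^sup>2 - \<theta> * S (b # w))" for b
  proof -
    let ?x = "- \<theta> * (S (b # w) - S w)"
    have x: "\<bar>?x\<bar> \<le> \<theta> * B" using incr[of b w] \<theta>(1) by (simp add: abs_mult)
    then have "\<bar>?x\<bar> \<le> 1" using \<theta>(2) by linarith
    then have "exp ?x \<le> 1 + ?x + ?x\<^sup>2" by (rule exp_quadratic_bound)
    also have "?x\<^sup>2 \<le> (\<theta> * B)\<^sup>2" using x by (rule power2_le_iff_abs_le[THEN iffD2, rotated]) (use x in linarith)
    finally have "exp ?x \<le> 1 + \<theta> * S w + \<theta>\<^sup>2 * B\<^sup>2 - \<theta> * S (b # w)"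
      by (simp add: algebra_simps power_mult_distrib)
    then have "exp (- \<theta> * S w) * exp ?x \<le> exp (- \<theta> * S w) * (1 + \<theta> * S w + \<theta>\<^sup>2 * B\<^sup>2 - \<theta> * S (b # w))"
      by (intro mult_left_mono) auto
    then show ?thesis by (simp add: exp_add[symmetric] algebra_simps)
  qed
  have "avg u (\<lambda>w. exp (- \<theta> * S w)) w
      \<le> avg u (\<lambda>v. exp (- \<theta> * S w) * ((1 + \<theta> * S w + \<theta>\<^sup>2 * B\<^sup>2) - \<theta> * S v)) w"
    by (rule avg_mono) (use step in \<open>simp add: algebra_simps\<close>)
  also have "\<dots> = exp (- \<theta> * S w) * (1 + \<theta> * S w + \<theta>\<^sup>2 * B\<^sup>2 - \<theta> * avg u S w)"
    by (simp add: avg_cmult avg_diff avg_const)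
  also have "\<dots> \<le> exp (- \<theta> * S w) * 1"
  proof (rule mult_left_mono)
    have "\<theta> * (S w + c) \<le> \<theta> * avg u S w" "\<theta> * (\<theta> * B\<^sup>2) \<le> \<theta> * c"
      using drift[of w] \<theta> by (auto intro: mult_left_mono)
    then show "1 + \<theta> * S w + \<theta>\<^sup>2 * B\<^sup>2 - \<theta> * avg u S w \<le> 1"
      by (simp add: algebra_simps power2_eq_square)
  qed simp
  finally show ?thesis by simp
qed

lemma positive_drift_stay:
  assumes c: "0 < c" and drift: "\<And>w. S w + c \<le> avg u S w"
    and near: "\<And>w. \<bar>S w - real (Suc L) * pos w\<bar> \<le> K"
  obtains N a where "0 < a" "\<And>w n. int N \<le> pos w \<Longrightarrow> a \<le> stay u {0<..} n w"
proof -
  define B where "B = real (Suc L) + 2 * K"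
  have K: "0 \<le> K" using near[of "[]"] by linarith
  then have B: "0 < B" by (simp add: B_def add_pos_nonneg)
  have incr: "\<bar>S (b # w) - S w\<bar> \<le> B" for b w
  proof -
    have "real (Suc L) * pos (b # w) - real (Suc L) * pos w = (if b then real (Suc L) else - real (Suc L))"
      by (cases b) (simp_all add: algebra_simps)
    then show ?thesis using near[of w] near[of "b # w"] unfolding B_def by (auto split: if_splits)
  qed
  define \<theta> where "\<theta> = min (1 / B) (c / B\<^sup>2)"
  have \<theta>: "0 < \<theta>" "\<theta> * B \<le> 1" "\<theta> * B\<^sup>2 \<le> c"
  proof -
    show "0 < \<theta>" using B c by (simp add: \<theta>_def)
    have "\<theta> \<le> 1 / B" "\<theta> \<le> c / B\<^sup>2" by (simp_all add: \<theta>_def)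
    then show "\<theta> * B \<le> 1" "\<theta> * B\<^sup>2 \<le> c" using B by (simp_all add: pos_le_divide_eq)
  qed
  \<comment> \<open>The factor \<open>exp (\<theta> * K)\<close> makes \<open>\<psi>\<close>
    nonpositive at position 0, where \<open>S\<close> is at most \<open>K\<close>.\<close>
  define \<psi> where "\<psi> w = 1 - exp (\<theta> * K) * exp (- \<theta> * S w)" for w
  have sub: "\<psi> w \<le> avg u \<psi> w" for w
    using exp_supermartingale[OF drift incr \<theta>, of w]
    unfolding \<psi>_def by (simp add: avg_diff avg_const avg_cmult)
  have le1: "\<psi> w \<le> 1" for w by (simp add: \<psi>_def)
  have le0: "\<psi> w \<le> 0" if "pos w = 0" for w
  proof -
    have "\<theta> * S w \<le> \<theta> * K" using near[of w] that \<theta>(1) by (intro mult_left_mono) auto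
    then show ?thesis by (simp add: \<psi>_def exp_add[symmetric])
  qed
  \<comment> \<open>From this height on, \<open>S\<close> is at least \<open>K + 1\<close>, which
    bounds \<open>\<psi>\<close> below by \<open>1 - exp (- \<theta>)\<close>.\<close>
  define N where "N = nat \<lceil>2 * K + 1\<rceil>"
  show ?thesis
  proof (rule that)
    show "0 < 1 - exp (- \<theta>)" using \<theta> by simp
    fix w n assume w: "int N \<le> pos w"
    have "2 * K + 1 \<le> real N" unfolding N_def by linarith
    also have "real N \<le> pos w" using w by linarith
    finally have pw: "2 * K + 1 \<le> pos w" .
    also have "\<dots> \<le> real (Suc L) * pos w"
      using K pw by (simp add: algebra_simps)
    finally have "K + 1 \<le> S w" using near[of w] by linarith
    then have "\<theta> * (K + 1) \<le> \<theta> * S w" using \<theta>(1) by (intro mult_left_mono) auto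
    then have "1 - exp (- \<theta>) \<le> \<psi> w" by (simp add: \<psi>_def exp_add[symmetric] algebra_simps)
    also have "\<psi> w \<le> stay u {0<..} n w"
      using w by (intro stay_positive_ge sub le1 le0) auto
    finally show "1 - exp (- \<theta>) \<le> stay u {0<..} n w" .
  qed
qed

end

section \<open>Comparison with the symmetric walk when \<open>1 < p + q\<close>\<close>

lemma stay_bias_lower:
  assumes "0 < p" "p < 1" "0 < q" "q < 1" "0 < L" "1 < p + q"
  obtains N a where "0 < a" "\<And>w n. int N \<le> pos w \<Longrightarrow> a \<le> stay (bias p q L) {0<..} n w"
proof -
  let ?v = "bias p (1 - p) L" and ?u = "bias p q L" and ?s = "replicate L False"
  interpret base: symmetric_memory ?v "min p (1 - p)" L
    using assms by (intro symmetric_memory_bias)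
  interpret elliptic ?u "min (min p (1 - p)) (min q (1 - q))"
    using assms by (intro elliptic_bias)
  \<comment> \<open>Changing the probability of a step up by some amount changes the expected next
    potential by that amount times \<open>gap\<close>.\<close>
  define gap where "gap w = base.potential (True # w) - base.potential (False # w)" for w
  have gap_nonneg: "0 \<le> gap w" for w
  proof -
    have "base.potential (False # w) \<le> base.potential (True # w)"
      by (rule LIMSEQ_le[OF base.potential_limit base.potential_limit])
        (use avg_pow_step_mono[of p] assms in blast)
    then show ?thesis by (simp add: gap_def)
  qed
  have gap_take: "gap (take L w) = gap w" for w
    using base.corrector_take[of "True # take L w"] base.corrector_take[of "False # take L w"]
      base.corrector_take[of "True # w"] base.corrector_take[of "False # w"]
    by (simp add: gap_def base.potential_def take_Cons_take)
  have avg_v: "base.potential w = base.potential (False # w) + ?v w * gap w" for w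
    using base.avg_potential[of w] by (simp add: avg_def gap_def algebra_simps)
  have "gap ?s \<noteq> 0"
  proof
    assume "gap ?s = 0"
    then have "base.potential ?s = base.potential (False # ?s)" using avg_v[of ?s] by simp
    \<comment> \<open>The window already consists of \<open>L\<close> steps down, so one more
      changes only the position.\<close>
    moreover have "base.corrector (False # ?s) = base.corrector ?s"
      using base.corrector_take[of "False # ?s"] \<open>0 < L\<close>
      by (simp add: replicate_Suc[symmetric] del: replicate_Suc)
    ultimately show False by (simp add: base.potential_def)
  qed
  then have gap_pos: "0 < gap ?s" using gap_nonneg[of ?s] by linarith
  have diff: "avg ?u base.potential w - base.potential w = (?u w - ?v w) * gap w" for w
    using avg_v[of w] by (simp add: avg_def gap_def algebra_simps)
  \<comment> \<open>The two biases differ only at a minimum that is not a maximum, where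
    \<open>q\<close> replaces \<open>1 - p\<close>.\<close>
  have u_ge: "?v w \<le> ?u w" for w using assms by (auto simp: bias_def)
  have sub: "base.potential w \<le> avg ?u base.potential w" for w
    using diff[of w] mult_nonneg_nonneg[of "?u w - ?v w" "gap w"] u_ge[of w] gap_nonneg[of w] by linarith
  have gain: "base.potential (?s @ w) + (p + q - 1) * gap ?s \<le> avg ?u base.potential (?s @ w)" for w
  proof -
    have "\<not> at_max L (?s @ w)"
      unfolding at_max_def using \<open>0 < L\<close> by (auto intro!: exI[of _ L])
    moreover have "at_min L (?s @ w)" by (auto simp: at_min_def)
    ultimately have "?u (?s @ w) - ?v (?s @ w) = p + q - 1" by (simp add: bias_def)
    then show ?thesis using diff[of "?s @ w"] gap_take[of "?s @ w"] by simp
  qed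
  obtain K where K: "\<And>w. \<bar>base.potential w - pos w\<bar> \<le> K" using base.potential_bounded by blast
  have s: "length ?s = L" "0 < (p + q - 1) * gap ?s" using assms gap_pos by auto
  obtain S K' c where S: "0 < c" "\<And>w. S w + c \<le> avg ?u S w"
    "\<And>w. \<bar>S w - real (Suc L) * pos w\<bar> \<le> K'"
    by (rule uniform_drift[OF K sub s(1) gain s(2)]) (rule that)
  show ?thesis by (rule positive_drift_stay[OF S]) (rule that)
qed

section \<open>Distribution of the walk\<close>

lemma eq_extremum_window:
  "x k = Max (window L x k) \<longleftrightarrow> (\<forall>m\<le>min L k. x (k - m) \<le> x k)"
  "x k = Min (window L x k) \<longleftrightarrow> (\<forall>m\<le>min L k. x k \<le> x (k - m))"
proof -
  have "finite (window L x k)" "x k \<in> window L x k"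
    by (auto simp: window_def intro!: image_eqI[of _ _ 0])
  moreover from this have "window L x k \<noteq> {}" by blast
  ultimately show "x k = Max (window L x k) \<longleftrightarrow> (\<forall>m\<le>min L k. x (k - m) \<le> x k)"
    "x k = Min (window L x k) \<longleftrightarrow> (\<forall>m\<le>min L k. x k \<le> x (k - m))"
    by (auto simp: eq_Max_iff eq_Min_iff) (auto simp: window_def)
qed

lemma up_prob_path:
  "up_prob p q L (\<lambda>i. pos (drop (length w - i) w)) (length w) = bias p q L w"
proof -
  let ?x = "\<lambda>i. pos (drop (length w - i) w)"
  \<comment> \<open>Since \<open>take m w\<close> is \<open>w\<close> once \<open>m\<close> exceeds
    the length, truncating the window at the start of the walk is automatic.\<close>
  have *: "(\<forall>m\<le>min L (length w). P (take m w)) \<longleftrightarrow> (\<forall>m\<le>L. P (take m w))" for P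
  proof (intro iffI allI impI)
    fix m
    assume "\<forall>m\<le>min L (length w). P (take m w)" "m \<le> L"
    then have "P (take (min m (length w)) w)" by auto
    then show "P (take m w)" by (cases "m \<le> length w") auto
  qed auto
  have "?x (length w) = Max (window L ?x (length w)) \<longleftrightarrow> at_max L w"
    using eq_extremum_window(1)[of ?x "length w" L] *[of "\<lambda>v. 0 \<le> pos v"]
    by (simp add: at_max_def pos_take_drop)
  moreover have "?x (length w) = Min (window L ?x (length w)) \<longleftrightarrow> at_min L w"
    using eq_extremum_window(2)[of ?x "length w" L] *[of "\<lambda>v. pos v \<le> 0"]
    by (simp add: at_min_def pos_take_drop)
  ultimately show ?thesis by (simp only: up_prob_def bias_def)
qed

text \<open>Negation exchanges maxima with minima and steps up with steps down, so the parameters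
  become \<open>1 - q\<close> at a maximum and \<open>1 - p\<close> at a minimum.\<close>

lemma up_prob_reflect:
  "up_prob (1 - q) (1 - p) L x k = 1 - up_prob p q L (\<lambda>i. - x i) k"
proof -
  have "- x k = Max (window L (\<lambda>i. - x i) k) \<longleftrightarrow> x k = Min (window L x k)"
    "- x k = Min (window L (\<lambda>i. - x i) k) \<longleftrightarrow> x k = Max (window L x k)"
    using eq_extremum_window[of x k L] eq_extremum_window[of "\<lambda>i. - x i" k L] by auto
  then show ?thesis unfolding up_prob_def by (simp only:) (simp split: if_split)
qed

lemma perturbed_extrema_walk_reflect:
  assumes "perturbed_extrema_walk M p q L X"
  shows "perturbed_extrema_walk M (1 - q) (1 - p) L (\<lambda>k \<omega>. - X k \<omega>)"
proof -
  interpret perturbed_extrema_walk M p q L X by fact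
  have neg: "- X i \<omega> = x \<longleftrightarrow> X i \<omega> = - x" for i \<omega> x by auto
  show ?thesis
  proof unfold_locales
    show "(\<lambda>\<omega>. - X k \<omega>) \<in> measurable M (count_space UNIV)" for k
      using random_variable[of k] by (rule measurable_compose) simp
    show "AE \<omega> in M. - X 0 \<omega> = 0" using start by simp
    fix k and x :: "nat \<Rightarrow> int"
    assume "0 < \<P>(\<omega> in M. \<forall>i\<le>k. - X i \<omega> = x i)"
    then have pos: "0 < \<P>(\<omega> in M. \<forall>i\<le>k. X i \<omega> = - x i)" by (simp add: neg)
    show "\<P>(\<omega> in M. - X (Suc k) \<omega> = x k + 1 \<bar> \<forall>i\<le>k. - X i \<omega> = x i) = up_prob (1 - q) (1 - p) L x k"
      using step_down[OF pos] by (simp add: neg up_prob_reflect)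
    show "\<P>(\<omega> in M. - X (Suc k) \<omega> = x k - 1 \<bar> \<forall>i\<le>k. - X i \<omega> = x i) = 1 - up_prob (1 - q) (1 - p) L x k"
      using step_up[OF pos] by (simp add: neg up_prob_reflect)
  qed
qed

lemma recurrent_reflect: "recurrent M (\<lambda>k \<omega>. - X k \<omega>) \<longleftrightarrow> recurrent M X"
  by (simp add: recurrent_def)

section \<open>Cylinder events and the behaviour of almost every path\<close>

context perturbed_extrema_walk
begin

declare random_variable [measurable]

definition cyl :: "bool list \<Rightarrow> 'a set" where
  "cyl w = {\<omega> \<in> space M. \<forall>i\<le>length w. X i \<omega> = pos (drop (length w - i) w)}"

lemma cyl_sets [measurable]: "cyl w \<in> sets M"
  unfolding cyl_def by measurable

lemma stay_event: "{\<omega> \<in> cyl w. \<forall>i\<le>n. X (length w + i) \<omega> \<in> Z} \<in> sets M"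
  by measurable

lemma cyl_Cons: "cyl (b # w) = {\<omega> \<in> cyl w. X (Suc (length w)) \<omega> = pos (b # w)}"
  by (auto simp: cyl_def le_Suc_eq Suc_diff_le)

lemma cyl_last: "\<omega> \<in> cyl w \<Longrightarrow> X (length w) \<omega> = pos w"
  by (auto simp: cyl_def)

lemma prob_cyl_Nil: "prob (cyl []) = 1"
proof -
  have "prob {\<omega> \<in> space M. X 0 \<omega> = 0} = 1"
    using start by (subst prob_Collect_eq_1) auto
  then show ?thesis by (simp add: cyl_def)
qed

lemma prob_cyl_Cons:
  "prob (cyl (True # w)) = bias p q L w * prob (cyl w)"
  "prob (cyl (False # w)) = (1 - bias p q L w) * prob (cyl w)"
proof -
  let ?x = "\<lambda>i. pos (drop (length w - i) w)"
  have C: "cyl w = {\<omega> \<in> space M. \<forall>i\<le>length w. X i \<omega> = ?x i}"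
    and T: "cyl (True # w) = {\<omega> \<in> space M. X (Suc (length w)) \<omega> = ?x (length w) + 1 \<and> (\<forall>i\<le>length w. X i \<omega> = ?x i)}"
    and F: "cyl (False # w) = {\<omega> \<in> space M. X (Suc (length w)) \<omega> = ?x (length w) - 1 \<and> (\<forall>i\<le>length w. X i \<omega> = ?x i)}"
    unfolding cyl_Cons by (auto simp: cyl_def)
  have "prob (cyl (True # w)) = bias p q L w * prob (cyl w)
      \<and> prob (cyl (False # w)) = (1 - bias p q L w) * prob (cyl w)"
  proof (cases "prob (cyl w) = 0")
    case True
    have "prob (cyl (b # w)) \<le> prob (cyl w)" for b
      by (rule finite_measure_mono) (auto simp: cyl_Cons)
    then have "prob (cyl (b # w)) = 0" for b
      using True measure_nonneg[of M "cyl (b # w)"] by (metis order_antisym)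
    then show ?thesis using True by simp
  next
    case False
    then have pos: "0 < \<P>(\<omega> in M. \<forall>i\<le>length w. X i \<omega> = ?x i)"
      unfolding C[symmetric] by (simp add: zero_less_measure_iff)
    show ?thesis
      using step_up[OF pos] step_down[OF pos] False
      unfolding cond_prob_def C[symmetric] T[symmetric] F[symmetric] up_prob_path
      by (simp add: field_simps)
  qed
  then show "prob (cyl (True # w)) = bias p q L w * prob (cyl w)"
    "prob (cyl (False # w)) = (1 - bias p q L w) * prob (cyl w)" by auto
qed

lemma cyl_disjoint: "cyl (True # w) \<inter> cyl (False # w) = {}"
  by (auto simp: cyl_Cons)

text \<open>The probabilities of the two disjoint extensions add up to that of \<open>cyl w\<close>,
  so the remainder is null.\<close>

lemma AE_cyl_step: "AE \<omega> in M. \<omega> \<in> cyl w \<longrightarrow> (\<exists>b. \<omega> \<in> cyl (b # w))"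
proof -
  have "prob (cyl (True # w) \<union> cyl (False # w)) = prob (cyl w)"
    using cyl_disjoint[of w] by (subst finite_measure_Union) (auto simp: prob_cyl_Cons algebra_simps)
  then have "prob (cyl w - (cyl (True # w) \<union> cyl (False # w))) = 0"
    by (subst finite_measure_Diff) (auto simp: cyl_Cons)
  then have "AE \<omega> in M. \<omega> \<notin> cyl w - (cyl (True # w) \<union> cyl (False # w))"
    by (subst (asm) prob_eq_0) auto
  then show ?thesis by eventually_elim (metis DiffI Un_iff)
qed

text \<open>Splitting \<open>cyl w\<close> by the next step reproduces the recursion of
  \<open>stay\<close>, up to a null set.\<close>

lemma prob_stay:
  "prob {\<omega> \<in> cyl w. \<forall>i\<le>n. X (length w + i) \<omega> \<in> Z} = prob (cyl w) * stay (bias p q L) Z n w"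
proof (induction n arbitrary: w)
  case 0
  have "{\<omega> \<in> cyl w. \<forall>i\<le>0. X (length w + i) \<omega> \<in> Z} = (if pos w \<in> Z then cyl w else {})"
    by (auto simp: cyl_last)
  then show ?case by simp
next
  case (Suc n)
  let ?E = "\<lambda>b. {\<omega> \<in> cyl (b # w). \<forall>i\<le>n. X (length (b # w) + i) \<omega> \<in> Z}"
  have E_sets: "?E b \<in> sets M" for b by (rule stay_event)
  show ?case
  proof (cases "pos w \<in> Z")
    case True
    have "prob {\<omega> \<in> cyl w. \<forall>i\<le>Suc n. X (length w + i) \<omega> \<in> Z} = prob (?E True \<union> ?E False)"
    proof (rule finite_measure_eq_AE)
      have all: "(\<forall>i\<le>Suc n. P i) \<longleftrightarrow> P 0 \<and> (\<forall>i\<le>n. P (Suc i))" for P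
        using All_less_Suc2[of "Suc n" P] by (simp add: less_Suc_eq_le)
      show "AE \<omega> in M. \<omega> \<in> {\<omega> \<in> cyl w. \<forall>i\<le>Suc n. X (length w + i) \<omega> \<in> Z}
          \<longleftrightarrow> \<omega> \<in> ?E True \<union> ?E False"
        using AE_cyl_step[of w]
      proof eventually_elim
        case (elim \<omega>)
        have "(\<exists>b. \<omega> \<in> cyl (b # w)) \<longleftrightarrow> \<omega> \<in> cyl (True # w) \<or> \<omega> \<in> cyl (False # w)"
          by (rule ex_bool_eq)
        moreover have "\<omega> \<in> cyl (b # w) \<Longrightarrow> \<omega> \<in> cyl w" for b by (simp add: cyl_Cons)
        ultimately show ?case using elim True cyl_last[of \<omega> w] unfolding all by auto
      qed
    qed (use E_sets in measurable)
    also have "\<dots> = prob (?E True) + prob (?E False)"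
      using cyl_disjoint[of w] E_sets by (intro finite_measure_Union) auto
    also have "\<dots> = prob (cyl w) * avg (bias p q L) (stay (bias p q L) Z n) w"
      by (simp only: Suc prob_cyl_Cons avg_def) (simp add: algebra_simps)
    finally show ?thesis using True by simp
  next
    case False
    then have "{\<omega> \<in> cyl w. \<forall>i\<le>Suc n. X (length w + i) \<omega> \<in> Z} = {}"
      using cyl_last by fastforce
    then show ?thesis using False by (simp only: stay.simps if_False) simp
  qed
qed

text \<open>There are only countably many histories, so one null set serves for all of them.\<close>

lemma AE_cyl: "AE \<omega> in M. \<forall>n. \<exists>w. length w = n \<and> \<omega> \<in> cyl w"
proof -
  have "AE \<omega> in M. X 0 \<omega> = 0" "AE \<omega> in M. \<forall>w. \<omega> \<in> cyl w \<longrightarrow> (\<exists>b. \<omega> \<in> cyl (b # w))"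
    using start AE_cyl_step by (simp_all add: AE_all_countable)
  then show ?thesis using AE_space
  proof eventually_elim
    case (elim \<omega>)
    show ?case
    proof
      show "\<exists>w. length w = n \<and> \<omega> \<in> cyl w" for n
      proof (induction n)
        case 0
        then show ?case using elim by (auto simp: cyl_def)
      next
        case (Suc n)
        then obtain w b where "length w = n" "\<omega> \<in> cyl (b # w)" using elim by blast
        then show ?case by (intro exI[of _ "b # w"]) simp
      qed
    qed
  qed
qed

lemma AE_steps: "AE \<omega> in M. \<forall>n. \<bar>X (Suc n) \<omega> - X n \<omega>\<bar> \<le> 1"
  using AE_cyl
proof eventually_elim
  case (elim \<omega>)
  show ?case
  proof
    fix n
    obtain b w where w: "length w = n" "\<omega> \<in> cyl (b # w)"
      using elim by (metis length_Suc_conv)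
    then have "\<omega> \<in> cyl w" by (simp add: cyl_Cons)
    then show "\<bar>X (Suc n) \<omega> - X n \<omega>\<bar> \<le> 1"
      using cyl_last[OF w(2)] cyl_last[of \<omega> w] w(1) by (cases b) auto
  qed
qed

text \<open>For each history, staying positive forever after it has probability 0 by
  \<open>stay_positive_vanishes\<close>; the countably many histories cover almost every
  path.\<close>

lemma AE_not_eventually_positive:
  assumes "0 < p" "p < 1" "0 < L" "p + q = 1"
  shows "AE \<omega> in M. \<forall>m. \<exists>n\<ge>m. X n \<omega> \<le> 0"
proof -
  have q: "q = 1 - p" using assms by simp
  interpret symmetric_memory "bias p q L" "min p (1 - p)" L
    unfolding q using assms by (intro symmetric_memory_bias)
  obtain K where K: "\<And>w. \<bar>potential w - pos w\<bar> \<le> K" using potential_bounded by blast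
  have "AE \<omega> in M. \<not> (\<omega> \<in> cyl w \<and> (\<forall>i. 0 < X (length w + i) \<omega>))" for w
  proof -
    let ?A = "{\<omega> \<in> cyl w. \<forall>i. 0 < X (length w + i) \<omega>}"
    have "prob ?A \<le> r" if "0 < r" for r
    proof -
      obtain n where n: "stay (bias p q L) {0<..} n w < r"
        using stay_positive_vanishes[OF avg_potential K \<open>0 < r\<close>] by blast
      have "prob ?A \<le> prob {\<omega> \<in> cyl w. \<forall>i\<le>n. X (length w + i) \<omega> \<in> {0<..}}"
        by (rule finite_measure_mono) auto
      also have "\<dots> \<le> 1 * stay (bias p q L) {0<..} n w"
        unfolding prob_stay by (intro mult_right_mono stay_nonneg) auto
      finally show ?thesis using n by simp
    qed
    then have "prob ?A = 0" using field_le_epsilon[of "prob ?A" 0] by (simp add: measure_le_0_iff)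
    then have "AE \<omega> in M. \<omega> \<notin> ?A" by (subst (asm) prob_eq_0) auto
    then show ?thesis by simp
  qed
  then have "AE \<omega> in M. \<forall>w. \<not> (\<omega> \<in> cyl w \<and> (\<forall>i. 0 < X (length w + i) \<omega>))"
    by (simp add: AE_all_countable)
  then show ?thesis using AE_cyl
  proof eventually_elim
    case (elim \<omega>)
    show ?case
    proof
      fix m
      obtain w where "length w = m" "\<omega> \<in> cyl w" using elim by blast
      then obtain i where "\<not> 0 < X (m + i) \<omega>" using elim by blast
      then show "\<exists>n\<ge>m. X n \<omega> \<le> 0" by (intro exI[of _ "m + i"]) auto
    qed
  qed
qed

lemma not_recurrent:
  assumes "0 < p" "p < 1" "0 < q" "q < 1" "0 < L" "1 < p + q"
  shows "\<not> recurrent M X"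
proof
  assume rec: "recurrent M X"
  interpret elliptic "bias p q L" "min (min p (1 - p)) (min q (1 - q))"
    using assms by (intro elliptic_bias)
  obtain N a where a: "0 < a" "\<And>w n. int N \<le> pos w \<Longrightarrow> a \<le> stay (bias p q L) {0<..} n w"
    by (rule stay_bias_lower[OF assms]) (rule that)
  \<comment> \<open>\<open>N\<close> initial steps up reach the height from which escape has
    probability at least \<open>a\<close>; ellipticity gives this start positive
    probability.\<close>
  define w where "w = replicate N True"
  have "0 < prob (cyl (replicate k True))" for k
    by (induction k) (simp_all add: prob_cyl_Nil prob_cyl_Cons u_bounds)
  then have w: "0 < prob (cyl w)" by (simp add: w_def)
  define A where "A n = {\<omega> \<in> cyl w. \<forall>i\<le>n. X (length w + i) \<omega> \<in> {0<..}}" for n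
  have A_sets: "range A \<subseteq> sets M"
    unfolding A_def using stay_event by blast
  have lim: "(\<lambda>n. prob (A n)) \<longlonglongrightarrow> prob (\<Inter>n. A n)"
    by (rule finite_Lim_measure_decseq[OF A_sets]) (auto simp: A_def decseq_def)
  have lower: "prob (cyl w) * a \<le> prob (A n)" for n
    unfolding A_def prob_stay by (intro mult_left_mono a) (simp_all add: w_def)
  have "prob (cyl w) * a \<le> prob (\<Inter>n. A n)"
    by (rule LIMSEQ_le_const[OF lim]) (use lower in blast)
  moreover have "prob (\<Inter>n. A n) = 0"
  proof (subst prob_eq_0)
    show "(\<Inter>n. A n) \<in> events" using A_sets by (intro sets.countable_INT) auto
    show "AE \<omega> in M. \<omega> \<notin> (\<Inter>n. A n)"
      using rec unfolding recurrent_def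
    proof eventually_elim
      case (elim \<omega>)
      then obtain n where n: "length w \<le> n" "X n \<omega> = 0"
        unfolding infinite_nat_iff_unbounded_le by blast
      show ?case
      proof
        assume "\<omega> \<in> (\<Inter>n. A n)"
        then have "X (length w + (n - length w)) \<omega> \<in> {0<..}" unfolding A_def by blast
        with n show False by simp
      qed
    qed
  qed
  ultimately show False using w a(1) mult_pos_pos[of "prob (cyl w)" a] by linarith
qed

end

text \<open>Discrete intermediate value theorem: between a nonpositive and a later nonnegative value
  there is a zero.\<close>

lemma infinite_zeros:
  fixes x :: "nat \<Rightarrow> int"
  assumes step: "\<And>n. \<bar>x (Suc n) - x n\<bar> \<le> 1"
    and "\<And>m. \<exists>n\<ge>m. x n \<le> 0" "\<And>m. \<exists>n\<ge>m. 0 \<le> x n"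
  shows "infinite {n. x n = 0}"
  unfolding infinite_nat_iff_unbounded_le
proof
  fix m
  obtain i where i: "m \<le> i" "x i \<le> 0" using assms(2) by blast
  obtain j where j: "i \<le> j" "0 \<le> x j" using assms(3) by blast
  obtain n where "i \<le> n" "x n = 0"
    using nat_intermed_int_val[of i j x 0] step i j by auto
  with i have "m \<le> n" "n \<in> {n. x n = 0}" by simp_all
  then show "\<exists>n\<ge>m. n \<in> {n. x n = 0}" by blast
qed

theorem theorem2:
  fixes p q :: real and L :: nat and M :: "'a measure" and X :: "nat \<Rightarrow> 'a \<Rightarrow> int"
  assumes "0 < p" "p < 1" "0 < q" "q < 1" "1 \<le> L"
    and "perturbed_extrema_walk M p q L X"
  shows "recurrent M X \<longleftrightarrow> p + q = 1"
proof
  interpret walk: perturbed_extrema_walk M p q L X by fact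
  \<comment> \<open>Reflection replaces \<open>p + q\<close> by \<open>2 - (p + q)\<close>: it turns
    \<open>p + q < 1\<close> into the transient case above 1 and preserves
    \<open>p + q = 1\<close>.\<close>
  interpret reflected: perturbed_extrema_walk M "1 - q" "1 - p" L "\<lambda>k \<omega>. - X k \<omega>"
    using assms(6) by (rule perturbed_extrema_walk_reflect)
  have L: "0 < L" using assms by simp
  {
    assume "recurrent M X"
    then have "\<not> 1 < p + q" "\<not> 1 < (1 - q) + (1 - p)"
      using walk.not_recurrent reflected.not_recurrent assms L recurrent_reflect[of M X] by auto
    then show "p + q = 1" by linarith
  next
    assume pq: "p + q = 1"
    have "AE \<omega> in M. \<forall>m. \<exists>n\<ge>m. X n \<omega> \<le> 0"
      by (rule walk.AE_not_eventually_positive) (use pq assms L in auto)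
    moreover have "AE \<omega> in M. \<forall>m. \<exists>n\<ge>m. - X n \<omega> \<le> 0"
      by (rule reflected.AE_not_eventually_positive) (use pq assms L in auto)
    ultimately show "recurrent M X"
      unfolding recurrent_def using walk.AE_steps
    proof eventually_elim
      case (elim \<omega>)
      then show ?case by (intro infinite_zeros) auto
    qed
  }
qed

end
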